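(* Let $n \geq 2$ be an integer and let $p_1 < p_2 < \dots < p_s$ be all the prime numbers that are at most $n+1$. Let $x_0$ be a positive integer with $\varphi(x_0) = n$. Then $x_0$ has the form $x_0 = p_1^{\alpha_1} \cdots p_s^{\alpha_s}$ with all $\alpha_i \in \mathbb{N}$, and moreover $$x_0 = n \cdot \left(\frac{p_1}{p_1 - 1}\right)^{\varepsilon_1} \cdots \left(\frac{p_s}{p_s - 1}\right)^{\varepsilon_s} \in \mathbb{Z},$$ where, for $1 \leq i \leq s$, $\varepsilon_i = 0$ if $\alpha_i = 0$ and $\varepsilon_i = 1$ if $\alpha_i \neq 0$.
   Context: $\varphi$ denotes Euler's totient function and $\mathbb{N} = \{0, 1, 2, \dots\}$. *)

theory Defs
  imports Complex_Main "HOL-Number_Theory.Number_Theory"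
begin

end

theory Submission
  imports Defs
begin

text \<open>If a prime q divides x, then q - 1 = totient q is at most totient x, so every prime
  factor of \<open>x\<^sub>0\<close> is at most n + 1 and hence among the \<open>p i\<close>.
  Euler's product formula, solved for x, expresses x as totient x times the product of q / (q - 1)
  over the primes q dividing x (\<open>of_nat_eq_totient_times_prod\<close>). The exponents
  \<open>\<epsilon> i\<close> select exactly these primes from the list, by unique factorization
  (\<open>prime_dvd_prod_prime_powers_iff\<close>). Integrality is then immediate, since the product
  equals \<open>x\<^sub>0\<close>.\<close>

lemma prime_dvd_imp_le_totient_Suc:
  fixes q x :: nat
  assumes "prime q" "q dvd x" "x > 0"
  shows "q \<le> totient x + 1"
  using totient_dvd_mono[OF assms(2,3)] totient_prime[OF assms(1)] by simp

text \<open>Each Euler factor 1 - 1/q has inverse q / (q - 1), because q > 1; multiplying Euler's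
  formula by these inverses isolates x. At x = 0 both sides vanish.\<close>

lemma of_nat_eq_totient_times_prod:
  fixes x :: nat
  shows "real x = real (totient x) * (\<Prod>q\<in>prime_factors x. real q / (real q - 1))"
proof -
  have "(1 - 1 / real q) * (real q / (real q - 1)) = 1" if "q \<in> prime_factors x" for q
  proof -
    have "q > 1"
      using that in_prime_factors_imp_prime prime_gt_1_nat by blast
    then show ?thesis
      by (simp add: field_simps)
  qed
  then have "(\<Prod>q\<in>prime_factors x. 1 - 1 / real q) * (\<Prod>q\<in>prime_factors x. real q / (real q - 1)) = 1"
    unfolding prod.distrib[symmetric] by (rule prod.neutral[OF ballI])
  then show ?thesis
    by (simp add: totient_formula2 mult.assoc)
qed

text \<open>A prime dividing the product divides some \<open>p i\<close>, hence equals it, and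
  injectivity identifies the index. This recovers the support of an arbitrary exponent vector from
  the number it represents.\<close>

lemma prime_dvd_prod_prime_powers_iff:
  fixes p :: "'i \<Rightarrow> nat"
  assumes "finite I" "inj_on p I" "\<And>i. i \<in> I \<Longrightarrow> prime (p i)" "j \<in> I"
  shows "p j dvd (\<Prod>i\<in>I. p i ^ a i) \<longleftrightarrow> a j \<noteq> 0"
proof
  assume "p j dvd (\<Prod>i\<in>I. p i ^ a i)"
  then obtain i where i: "i \<in> I" "p j dvd p i ^ a i"
    using assms by (auto simp: prime_dvd_prod_iff)
  then have "p j dvd p i"
    using assms prime_dvd_power by blast
  then have "p j = p i"
    using assms i primes_dvd_imp_eq by blast
  then have "i = j"
    using assms i inj_onD by metis
  \<comment> \<open>A zero exponent would make the prime \<open>p j\<close> divide 1.\<close>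
  then show "a j \<noteq> 0"
    using i assms(3)[of j] by (cases "a j = 0") auto
next
  assume "a j \<noteq> 0"
  then have "p j dvd p j ^ a j"
    by (simp add: dvd_power)
  also have "\<dots> dvd (\<Prod>i\<in>I. p i ^ a i)"
    using assms(1,4) by (rule dvd_prodI)
  finally show "p j dvd (\<Prod>i\<in>I. p i ^ a i)" .
qed

theorem lemma2:
  fixes n s x\<^sub>0 :: nat and p :: "nat \<Rightarrow> nat"
  assumes "n \<ge> 2"
    and "strict_mono_on {1..s} p"
    and "p ` {1..s} = {q. prime q \<and> q \<le> n + 1}"
    and "x\<^sub>0 > 0"
    and "totient x\<^sub>0 = n"
  shows "(\<exists>\<alpha> :: nat \<Rightarrow> nat. x\<^sub>0 = (\<Prod>i = 1..s. p i ^ \<alpha> i)) \<and>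
    (\<forall>\<alpha> \<epsilon> :: nat \<Rightarrow> nat.
      x\<^sub>0 = (\<Prod>i = 1..s. p i ^ \<alpha> i) \<longrightarrow>
      (\<forall>i \<in> {1..s}. \<epsilon> i = (if \<alpha> i = 0 then 0 else 1)) \<longrightarrow>
        real x\<^sub>0 = real n * (\<Prod>i = 1..s. (real (p i) / (real (p i) - 1)) ^ \<epsilon> i) \<and>
        real n * (\<Prod>i = 1..s. (real (p i) / (real (p i) - 1)) ^ \<epsilon> i) \<in> \<int>)"
proof -
  have inj: "inj_on p {1..s}"
    using assms(2) strict_mono_on_imp_inj_on by blast
  have pr: "prime (p i)" if "i \<in> {1..s}" for i
    using assms(3) that by blast
  have factors: "prime_factors x\<^sub>0 \<subseteq> p ` {1..s}"
    using assms(4,5) prime_dvd_imp_le_totient_Suc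
    unfolding assms(3) by (auto simp: prime_factors_dvd)
  have "x\<^sub>0 = (\<Prod>q\<in>prime_factors x\<^sub>0. q ^ multiplicity q x\<^sub>0)"
    using assms(4) by (rule prime_factorization_nat)
  \<comment> \<open>The primes added to the index set have multiplicity 0 in
    \<open>x\<^sub>0\<close> and contribute the factor 1.\<close>
  also have "\<dots> = (\<Prod>q\<in>p ` {1..s}. q ^ multiplicity q x\<^sub>0)"
    using factors assms(3)
    by (intro prod.mono_neutral_left) (auto simp: prime_factors_multiplicity)
  also have "\<dots> = (\<Prod>i = 1..s. p i ^ multiplicity (p i) x\<^sub>0)"
    using inj by (simp add: prod.reindex)
  finally have ex: "\<exists>\<alpha> :: nat \<Rightarrow> nat. x\<^sub>0 = (\<Prod>i = 1..s. p i ^ \<alpha> i)"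
    by (rule exI[where x = "\<lambda>i. multiplicity (p i) x\<^sub>0"])
  have formula: "real x\<^sub>0 = real n * (\<Prod>i = 1..s. (real (p i) / (real (p i) - 1)) ^ \<epsilon> i)"
    if \<alpha>: "x\<^sub>0 = (\<Prod>i = 1..s. p i ^ \<alpha> i)"
      and \<epsilon>: "\<forall>i \<in> {1..s}. \<epsilon> i = (if \<alpha> i = 0 then 0 else 1)"
    for \<alpha> \<epsilon> :: "nat \<Rightarrow> nat"
  proof -
    let ?f = "\<lambda>q. real q / (real q - 1)"
    \<comment> \<open>Here \<open>\<alpha>\<close> is any representation of
      \<open>x\<^sub>0\<close>, not just the one by multiplicities; this describes
      \<open>\<epsilon>\<close> through \<open>x\<^sub>0\<close> alone.\<close>
    have \<epsilon>_iff: "\<epsilon> i = (if p i \<in> prime_factors x\<^sub>0 then 1 else 0)" if "i \<in> {1..s}" for i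
    proof -
      have "p i dvd x\<^sub>0 \<longleftrightarrow> \<alpha> i \<noteq> 0"
        unfolding \<alpha> using inj pr that by (intro prime_dvd_prod_prime_powers_iff) auto
      then show ?thesis
        using \<epsilon> pr that assms(4) by (simp add: prime_factors_dvd)
    qed
    \<comment> \<open>Exponents 0 and 1 extend the product to all listed primes, so that it can be
      reindexed along \<open>p\<close>.\<close>
    have "(\<Prod>q\<in>prime_factors x\<^sub>0. ?f q)
        = (\<Prod>q\<in>p ` {1..s}. ?f q ^ (if q \<in> prime_factors x\<^sub>0 then 1 else 0))"
      using factors by (intro prod.mono_neutral_cong_left) auto
    also have "\<dots> = (\<Prod>i = 1..s. ?f (p i) ^ (if p i \<in> prime_factors x\<^sub>0 then 1 else 0))"
      using inj by (simp only: prod.reindex o_def)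
    also have "\<dots> = (\<Prod>i = 1..s. ?f (p i) ^ \<epsilon> i)"
      by (intro prod.cong refl) (simp only: \<epsilon>_iff)
    finally show ?thesis
      using of_nat_eq_totient_times_prod[of x\<^sub>0] assms(5) by simp
  qed
  have "real n * (\<Prod>i = 1..s. (real (p i) / (real (p i) - 1)) ^ \<epsilon> i) \<in> \<int>"
    if "x\<^sub>0 = (\<Prod>i = 1..s. p i ^ \<alpha> i)"
      and "\<forall>i \<in> {1..s}. \<epsilon> i = (if \<alpha> i = 0 then 0 else 1)"
    for \<alpha> \<epsilon> :: "nat \<Rightarrow> nat"
    using formula[OF that] Ints_of_nat[of x\<^sub>0] by metis
  with ex formula show ?thesis
    by blast
qed

end
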